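(* For any instance $(G,H)$ of Directed Multicut, the optimum values of the Label-LP and of the distance LP coincide, both for the fractional relaxations and for the integral versions (all variables restricted to $\{0,1\}$).
   Context: Directed Multicut instance: directed supply graph $G=(V_G,E)$ with nonnegative edge weights $w_e$, directed simple demand graph $H$ with vertex set $V_H=\{s_1,\dots,s_k\}\subseteq V_G$ and edge set $E_H$; a feasible solution is $E'\subseteq E$ such that for every $(s_i,s_j)\in E_H$ there is no directed $s_i$-$s_j$ path in $G-E'$. Distance LP: minimize $\sum_{e\in E} w_e x_e$ subject to $\sum_{e\in p}x_e\ge 1$ for every directed path $p$ from $s_i$ to $s_j$ in $G$ with $(s_i,s_j)\in E_H$, and $x_e\ge 0$. Label-LP: let $L=\{0,1\}^k$, with $\sigma[i]$ the $i$-th bit of $\sigma\in L$ and $\sigma_1\le\sigma_2$ iff $\sigma_1[i]\le\sigma_2[i]$ for all $i$. Variables $z_{v,\sigma}$ ($v\in V_G,\sigma\in L$), $z_{e,\sigma_1\sigma_2}$ ($e\in E,\sigma_1,\sigma_2\in L$), $x_e$ ($e\in E$). Minimize $\sum_{e\in E} w_e x_e$ subject to: $\sum_{\sigma\in L} z_{v,\sigma}=1$ for all $v\in V_G$; $z_{s_i,\sigma}=0$ for all $i$ and all $\sigma$ with $\sigma[i]=0$; $z_{s_j,\sigma}=0$ for all $(s_i,s_j)\in E_H$ and all $\sigma$ with $\sigma[i]=1$; for every $e=(u,v)\in E$: $\sum_{\sigma_2\in L} z_{e,\sigma_1\sigma_2}=z_{u,\sigma_1}$ for all $\sigma_1\in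 L$, $\sum_{\sigma_1\in L} z_{e,\sigma_1\sigma_2}=z_{v,\sigma_2}$ for all $\sigma_2\in L$, and $x_e=\sum_{\sigma_1,\sigma_2\in L:\ \sigma_1\not\le\sigma_2} z_{e,\sigma_1\sigma_2}$; and $0\le z_{v,\sigma}, z_{e,\sigma_1\sigma_2}\le 1$. *)

theory Defs
  imports Complex_Main "HOL-Library.FuncSet" "Graph_Theory.Arc_Walk"
begin

text \<open>
  In Graph_Theory, \<^locale>\<open>fin_digraph\<close> admits loops and parallel arcs, whereas
  \<^locale>\<open>digraph\<close> is finite, loop-free and without parallel arcs, i.e. simple.
\<close>

locale directed_multicut = G: fin_digraph G + H: digraph H
  for G :: "('a, 'b) pre_digraph" and H :: "('a, 'c) pre_digraph" +
  fixes w :: "'b \<Rightarrow> real" and k :: nat and s :: "nat \<Rightarrow> 'a"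
  assumes weight_nonneg: "e \<in> arcs G \<Longrightarrow> 0 \<le> w e"
    and terminals_inj: "inj_on s {1..k}"
    and terminals: "verts H = s ` {1..k}"
    and terminals_in_supply: "verts H \<subseteq> verts G"

text \<open>Only the values of LP variables at indices occurring in the LP are constrained.\<close>

definition cost :: "('a, 'b) pre_digraph \<Rightarrow> ('b \<Rightarrow> real) \<Rightarrow> ('b \<Rightarrow> real) \<Rightarrow> real" where
  "cost G w x = (\<Sum>e\<in>arcs G. w e * x e)"

definition distance_lp ::
  "('a, 'b) pre_digraph \<Rightarrow> ('a, 'c) pre_digraph \<Rightarrow> ('b \<Rightarrow> real) \<Rightarrow> bool" where
  "distance_lp G H x \<longleftrightarrow>
     (\<forall>u v p. (u, v) \<in> arcs_ends H \<and> pre_digraph.apath G u p v \<longrightarrow> (\<Sum>e\<in>set p. x e) \<ge> 1) \<and>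
     (\<forall>e\<in>arcs G. x e \<ge> 0)"

definition distance_ip ::
  "('a, 'b) pre_digraph \<Rightarrow> ('a, 'c) pre_digraph \<Rightarrow> ('b \<Rightarrow> real) \<Rightarrow> bool" where
  "distance_ip G H x \<longleftrightarrow> distance_lp G H x \<and> (\<forall>e\<in>arcs G. x e \<in> {0, 1})"

type_synonym label = "nat \<Rightarrow> nat"

definition labels :: "nat \<Rightarrow> label set" where
  "labels k = {1..k} \<rightarrow>\<^sub>E {0, 1}"

definition label_le :: "nat \<Rightarrow> label \<Rightarrow> label \<Rightarrow> bool" where
  "label_le k \<sigma>\<^sub>1 \<sigma>\<^sub>2 \<longleftrightarrow> (\<forall>i\<in>{1..k}. \<sigma>\<^sub>1 i \<le> \<sigma>\<^sub>2 i)"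

type_synonym ('a, 'b) label_vars =
  "('a \<Rightarrow> label \<Rightarrow> real) \<times> ('b \<Rightarrow> label \<Rightarrow> label \<Rightarrow> real) \<times> ('b \<Rightarrow> real)"

fun label_lp ::
  "('a, 'b) pre_digraph \<Rightarrow> ('a, 'c) pre_digraph \<Rightarrow> nat \<Rightarrow> (nat \<Rightarrow> 'a) \<Rightarrow> ('a, 'b) label_vars \<Rightarrow> bool"
where
  "label_lp G H k s (zv, ze, x) \<longleftrightarrow>
     (\<forall>v\<in>verts G. (\<Sum>\<sigma>\<in>labels k. zv v \<sigma>) = 1) \<and>
     (\<forall>i\<in>{1..k}. \<forall>\<sigma>\<in>labels k. \<sigma> i = 0 \<longrightarrow> zv (s i) \<sigma> = 0) \<and>
     (\<forall>i\<in>{1..k}. \<forall>j\<in>{1..k}. (s i, s j) \<in> arcs_ends H \<longrightarrow>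
        (\<forall>\<sigma>\<in>labels k. \<sigma> i = 1 \<longrightarrow> zv (s j) \<sigma> = 0)) \<and>
     (\<forall>e\<in>arcs G.
        (\<forall>\<sigma>\<^sub>1\<in>labels k. (\<Sum>\<sigma>\<^sub>2\<in>labels k. ze e \<sigma>\<^sub>1 \<sigma>\<^sub>2) = zv (tail G e) \<sigma>\<^sub>1) \<and>
        (\<forall>\<sigma>\<^sub>2\<in>labels k. (\<Sum>\<sigma>\<^sub>1\<in>labels k. ze e \<sigma>\<^sub>1 \<sigma>\<^sub>2) = zv (head G e) \<sigma>\<^sub>2) \<and>
        x e = (\<Sum>(\<sigma>\<^sub>1, \<sigma>\<^sub>2)\<in>{(\<sigma>\<^sub>1, \<sigma>\<^sub>2) \<in> labels k \<times> labels k. \<not> label_le k \<sigma>\<^sub>1 \<sigma>\<^sub>2}. ze e \<sigma>\<^sub>1 \<sigma>\<^sub>2)) \<and>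
     (\<forall>v\<in>verts G. \<forall>\<sigma>\<in>labels k. 0 \<le> zv v \<sigma> \<and> zv v \<sigma> \<le> 1) \<and>
     (\<forall>e\<in>arcs G. \<forall>\<sigma>\<^sub>1\<in>labels k. \<forall>\<sigma>\<^sub>2\<in>labels k. 0 \<le> ze e \<sigma>\<^sub>1 \<sigma>\<^sub>2 \<and> ze e \<sigma>\<^sub>1 \<sigma>\<^sub>2 \<le> 1)"

fun label_ip ::
  "('a, 'b) pre_digraph \<Rightarrow> ('a, 'c) pre_digraph \<Rightarrow> nat \<Rightarrow> (nat \<Rightarrow> 'a) \<Rightarrow> ('a, 'b) label_vars \<Rightarrow> bool"
where
  "label_ip G H k s (zv, ze, x) \<longleftrightarrow> label_lp G H k s (zv, ze, x) \<and>
     (\<forall>v\<in>verts G. \<forall>\<sigma>\<in>labels k. zv v \<sigma> \<in> {0, 1}) \<and>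
     (\<forall>e\<in>arcs G. \<forall>\<sigma>\<^sub>1\<in>labels k. \<forall>\<sigma>\<^sub>2\<in>labels k. ze e \<sigma>\<^sub>1 \<sigma>\<^sub>2 \<in> {0, 1}) \<and>
     (\<forall>e\<in>arcs G. x e \<in> {0, 1})"

fun label_cost :: "('a, 'b) pre_digraph \<Rightarrow> ('b \<Rightarrow> real) \<Rightarrow> ('a, 'b) label_vars \<Rightarrow> real" where
  "label_cost G w (zv, ze, x) = cost G w x"

definition is_opt_value :: "('y \<Rightarrow> bool) \<Rightarrow> ('y \<Rightarrow> real) \<Rightarrow> real \<Rightarrow> bool" where
  "is_opt_value feasible c m \<longleftrightarrow> (\<exists>y. is_arg_min c feasible y \<and> c y = m)"

end

theory Submission
  imports Defs "HOL-Analysis.Analysis"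
begin

text \<open>
  If \<open>(zv, ze, x)\<close> is feasible for the Label-LP, then for each terminal \<open>s\<^sub>i\<close> the potential
  \<open>f\<^sub>i v = (\<Sum>\<sigma> with \<sigma> i = 1. zv v \<sigma>)\<close> drops by at most \<open>x e\<close> along an arc \<open>e\<close>, and it drops from 1
  to 0 between the ends of a demand arc starting in \<open>s\<^sub>i\<close>; hence \<open>x\<close> is feasible for the distance LP.

  Conversely, let \<open>x\<close> be feasible for the distance LP and draw \<open>\<theta>\<close> uniformly from \<open>[0, 1)\<close>. Give \<open>v\<close>
  the random label whose \<open>i\<close>-th bit says whether \<open>v\<close> is within distance \<open>\<theta>\<close> of \<open>s\<^sub>i\<close>. Using the same
  \<open>\<theta>\<close> at both ends of an arc would be too expensive, since the violations for different \<open>i\<close> add up.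
  Instead, \<open>\<theta>\<close> at the tail of \<open>e\<close> is coupled with \<open>\<theta> + x e\<close> modulo 1 at the head: the marginals are
  unchanged, and by the triangle inequality the labels are ordered unless \<open>\<theta> + x e\<close> wraps around,
  which has probability at most \<open>x e\<close>. For integral \<open>x\<close> the labels do not depend on \<open>\<theta>\<close>.

  The optimum of the distance LP is attained because capping at 1 reduces the problem to a
  compact set; by the two translations it is then also the optimum of the Label-LP.
\<close>

section \<open>Probabilities of events in a uniform threshold\<close>

definition unif :: "(real \<Rightarrow> bool) \<Rightarrow> real" where
  "unif P = measure lborel {\<theta> \<in> {0..<1}. P \<theta>}"

lemma unif_cong: "(\<And>\<theta>. 0 \<le> \<theta> \<Longrightarrow> \<theta> < 1 \<Longrightarrow> P \<theta> \<longleftrightarrow> Q \<theta>) \<Longrightarrow> unif P = unif Q"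
  unfolding unif_def by (rule arg_cong[where f = "measure lborel"]) auto

lemma unif_nonneg: "0 \<le> unif P"
  by (simp add: unif_def)

lemma unif_True: "unif (\<lambda>_. True) = 1"
proof -
  have "{\<theta> \<in> {0..<1}. True} = {0..<1::real}" by auto
  then show ?thesis by (simp add: unif_def)
qed

lemma unif_False: "unif (\<lambda>_. False) = 0"
  by (simp add: unif_def)

lemma unif_eq_0: "(\<And>\<theta>. 0 \<le> \<theta> \<Longrightarrow> \<theta> < 1 \<Longrightarrow> \<not> P \<theta>) \<Longrightarrow> unif P = 0"
  using unif_cong[of P "\<lambda>_. False"] unif_False by simp

lemma fmeasurable_unit_part:
  assumes "{\<theta>::real. P \<theta>} \<in> sets borel"
  shows "{\<theta> \<in> {0..<1}. P \<theta>} \<in> fmeasurable lborel"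
proof -
  have "{\<theta> \<in> {0..<1}. P \<theta>} = {0..<1} \<inter> {\<theta>. P \<theta>}" by auto
  moreover have "\<dots> \<in> fmeasurable lborel"
    using assms by (intro fmeasurable_Int_fmeasurable fmeasurableI) auto
  ultimately show ?thesis by simp
qed

lemma unif_mono:
  assumes "{\<theta>. P \<theta>} \<in> sets borel" "{\<theta>. Q \<theta>} \<in> sets borel"
    and "\<And>\<theta>. 0 \<le> \<theta> \<Longrightarrow> \<theta> < 1 \<Longrightarrow> P \<theta> \<Longrightarrow> Q \<theta>"
  shows "unif P \<le> unif Q"
  unfolding unif_def
  by (rule measure_mono_fmeasurable)
    (use assms fmeasurable_unit_part[of P] fmeasurable_unit_part[of Q] in \<open>auto simp: fmeasurable_def\<close>)

lemma unif_le_1: "{\<theta>. P \<theta>} \<in> sets borel \<Longrightarrow> unif P \<le> 1"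
  using unif_mono[of P "\<lambda>_. True"] by (simp add: unif_True)

text \<open>Yields 0/1 label variables from an integral \<open>x\<close>, whose labels do not depend
  on the threshold.\<close>

lemma unif_constant:
  assumes "\<And>\<theta>. 0 \<le> \<theta> \<Longrightarrow> \<theta> < 1 \<Longrightarrow> P \<theta> \<longleftrightarrow> P 0"
  shows "unif P \<in> {0, 1}"
  using unif_cong[of P "\<lambda>_. P 0"] assms by (cases "P 0") (auto simp: unif_True unif_False)

text \<open>Finite additivity over disjoint fibres. It turns the sums of variables in the Label-LP
  into probabilities of single events.\<close>

lemma sum_unif_fibres:
  assumes "finite S" and "\<And>c. c \<in> S \<Longrightarrow> {\<theta>. f \<theta> = c} \<in> sets borel"
  shows "(\<Sum>c\<in>S. unif (\<lambda>\<theta>. f \<theta> = c)) = unif (\<lambda>\<theta>. f \<theta> \<in> S)"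
proof -
  have "measure lborel (\<Union>c\<in>S. {\<theta> \<in> {0..<1}. f \<theta> = c})
      = (\<Sum>c\<in>S. measure lborel {\<theta> \<in> {0..<1}. f \<theta> = c})"
  proof (rule measure_finite_Union)
    fix c assume "c \<in> S"
    then show "emeasure lborel {\<theta> \<in> {0..<1}. f \<theta> = c} \<noteq> \<infinity>"
      using fmeasurable_unit_part[OF assms(2)] 
      by (metis fmeasurableD2 infinity_ennreal_def)
  qed (use assms fmeasurable_unit_part[OF assms(2)] in
      \<open>auto simp: disjoint_family_on_def fmeasurable_def\<close>)
  moreover have "(\<Union>c\<in>S. {\<theta> \<in> {0..<1}. f \<theta> = c}) = {\<theta> \<in> {0..<1}. f \<theta> \<in> S}" by auto
  ultimately show ?thesis by (simp add: unif_def)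
qed

section \<open>Rotation of the unit interval\<close>

definition unit_shift :: "real \<Rightarrow> real \<Rightarrow> real" where
  "unit_shift a \<theta> = (if \<theta> + a < 1 then \<theta> + a else \<theta> + a - 1)"

lemma unit_shift_range:
  assumes "0 \<le> a" "a \<le> 1" "0 \<le> \<theta>" "\<theta> < 1"
  shows "0 \<le> unit_shift a \<theta>" "unit_shift a \<theta> < 1"
  using assms by (auto simp: unit_shift_def)

lemma unit_shift_measurable [measurable]: "unit_shift a \<in> borel_measurable borel"
  unfolding unit_shift_def by measurable

lemma borel_unit_shift_vimage:
  assumes "{\<theta>. P \<theta>} \<in> sets borel"
  shows "{\<theta>. P (unit_shift a \<theta>)} \<in> sets borel"
  using measurable_sets[OF unit_shift_measurable assms, of a] by (simp add: vimage_def)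

text \<open>Rotation preserves measure: the preimage of an event splits into the thresholds that do
  not wrap around (\<open>B1\<close>) and those that do (\<open>B2\<close>). These are translates of
  the parts of the event in \<open>[a, 1)\<close> and in \<open>[0, a)\<close>.\<close>

lemma unif_unit_shift:
  assumes a: "0 \<le> a" "a \<le> 1" and P: "{\<theta>. P \<theta>} \<in> sets borel"
  shows "unif (\<lambda>\<theta>. P (unit_shift a \<theta>)) = unif P"
proof -
  define A where "A = {\<theta>. P \<theta>}"
  have A: "A \<in> sets borel" using P by (simp add: A_def)
  define B1 B2 where "B1 = (\<lambda>y. - a + y) ` (A \<inter> {a..<1})"
    and "B2 = (\<lambda>y. (1 - a) + y) ` (A \<inter> {0..<a})"
  have eq1: "B1 = {\<theta> \<in> {0..<1-a}. \<theta> + a \<in> A}"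
  proof (intro set_eqI iffI)
    fix \<theta> assume "\<theta> \<in> {\<theta> \<in> {0..<1-a}. \<theta> + a \<in> A}"
    then show "\<theta> \<in> B1" unfolding B1_def by (intro image_eqI[of _ _ "\<theta> + a"]) auto
  qed (auto simp: B1_def)
  have eq2: "B2 = {\<theta> \<in> {1-a..<1}. \<theta> + (a - 1) \<in> A}"
  proof (intro set_eqI iffI)
    fix \<theta> assume "\<theta> \<in> {\<theta> \<in> {1-a..<1}. \<theta> + (a - 1) \<in> A}"
    then show "\<theta> \<in> B2" unfolding B2_def by (intro image_eqI[of _ _ "\<theta> + (a - 1)"]) auto
  qed (auto simp: B2_def)
  have [measurable]: "A \<in> sets borel" by (rule A)
  have b1: "B1 \<in> sets borel" unfolding eq1 by measurable
  have b2: "B2 \<in> sets borel" unfolding eq2 by measurable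
  have add: "measure lborel (C \<union> C') = measure lborel C + measure lborel C'"
    if C: "C \<in> sets borel" "C \<subseteq> {0..<1}" and C': "C' \<in> sets borel" "C' \<subseteq> {0..<1}"
      and "C \<inter> C' = {}" for C C' :: "real set"
  proof -
    have "B \<in> fmeasurable lborel" if "B \<in> sets borel" "B \<subseteq> {0..<1}" for B :: "real set"
      using that by (intro fmeasurableI2[OF _ that(2)] fmeasurableI[of "{0..<1}"]) auto
    with that show ?thesis
      by (intro measure_Union) (metis fmeasurableD2 infinity_ennreal_def sets_lborel)+
  qed
  \<comment> \<open>\<open>measure_translation\<close> speaks of Lebesgue measure, the completion of
    \<open>lborel\<close>; on Borel sets the two agree.\<close>
  have translate: "measure lborel ((\<lambda>y. c + y) ` C) = measure lborel C"
    if "C \<in> sets borel" "(\<lambda>y. c + y) ` C \<in> sets borel" for C and c :: real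
    using that measure_translation[of c C] by (simp add: measure_completion)
  have "{\<theta> \<in> {0..<1}. P (unit_shift a \<theta>)} = B1 \<union> B2"
    unfolding eq1 eq2 A_def using a by (auto simp: unit_shift_def algebra_simps)
  then have "unif (\<lambda>\<theta>. P (unit_shift a \<theta>)) = measure lborel (B1 \<union> B2)"
    by (simp add: unif_def)
  also have "\<dots> = measure lborel B1 + measure lborel B2"
    using a b1 b2 by (intro add) (auto simp: eq1 eq2)
  also have "measure lborel B1 = measure lborel (A \<inter> {a..<1})"
    using b1 A unfolding B1_def by (intro translate) auto
  also have "measure lborel B2 = measure lborel (A \<inter> {0..<a})"
    using b2 A unfolding B2_def by (intro translate) auto
  also have "measure lborel (A \<inter> {a..<1}) + measure lborel (A \<inter> {0..<a})
      = measure lborel ((A \<inter> {a..<1}) \<union> (A \<inter> {0..<a}))"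
    using a A by (intro add[symmetric]) auto
  also have "(A \<inter> {a..<1}) \<union> (A \<inter> {0..<a}) = {\<theta> \<in> {0..<1}. P \<theta>}"
    using a by (auto simp: A_def)
  finally show ?thesis by (simp add: unif_def)
qed

section \<open>From labellings to distances\<close>

lemma finite_labels: "finite (labels k)"
  unfolding labels_def by (intro finite_PiE) auto

lemma labels_cases: "\<sigma> \<in> labels k \<Longrightarrow> i \<in> {1..k} \<Longrightarrow> \<sigma> i = 0 \<or> \<sigma> i = 1"
  by (auto simp: labels_def PiE_iff)

text \<open>The drops of the potential \<open>f\<close> telescope along the walk.\<close>

lemma sum_tail_minus_head_le:
  fixes f :: "'a \<Rightarrow> real"
  assumes "pre_digraph.cas G u p v" "set p \<subseteq> arcs G"
    and "\<And>e. e \<in> arcs G \<Longrightarrow> f (tail G e) - f (head G e) \<le> x e"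
  shows "f u - f v \<le> sum_list (map x p)"
  using assms(1,2)
proof (induction p arbitrary: u)
  case Nil
  then show ?case by (simp add: pre_digraph.cas.simps)
next
  case (Cons e p)
  then have "f (head G e) - f v \<le> sum_list (map x p)" "u = tail G e" "e \<in> arcs G"
    by (auto simp: pre_digraph.cas.simps)
  then show ?case using assms(3)[of e] by simp
qed

context directed_multicut
begin

lemma label_lp_imp_distance_lp:
  assumes "label_lp G H k s (zv, ze, x)"
  shows "distance_lp G H x"
proof -
  let ?L = "labels k"
  let ?bad = "{(\<sigma>\<^sub>1, \<sigma>\<^sub>2) \<in> ?L \<times> ?L. \<not> label_le k \<sigma>\<^sub>1 \<sigma>\<^sub>2}"
  note fin = finite_labels[of k]
  have tot: "\<And>v. v \<in> verts G \<Longrightarrow> (\<Sum>\<sigma>\<in>?L. zv v \<sigma>) = 1"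
    and src: "\<And>i \<sigma>. i \<in> {1..k} \<Longrightarrow> \<sigma> \<in> ?L \<Longrightarrow> \<sigma> i = 0 \<Longrightarrow> zv (s i) \<sigma> = 0"
    and snk: "\<And>i j \<sigma>. i \<in> {1..k} \<Longrightarrow> j \<in> {1..k} \<Longrightarrow> (s i, s j) \<in> arcs_ends H \<Longrightarrow>
        \<sigma> \<in> ?L \<Longrightarrow> \<sigma> i = 1 \<Longrightarrow> zv (s j) \<sigma> = 0"
    and tl: "\<And>e \<sigma>. e \<in> arcs G \<Longrightarrow> \<sigma> \<in> ?L \<Longrightarrow> zv (tail G e) \<sigma> = (\<Sum>\<sigma>\<^sub>2\<in>?L. ze e \<sigma> \<sigma>\<^sub>2)"
    and hd: "\<And>e \<sigma>. e \<in> arcs G \<Longrightarrow> \<sigma> \<in> ?L \<Longrightarrow> zv (head G e) \<sigma> = (\<Sum>\<sigma>\<^sub>1\<in>?L. ze e \<sigma>\<^sub>1 \<sigma>)"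
    and xe: "\<And>e. e \<in> arcs G \<Longrightarrow> x e = (\<Sum>(\<sigma>\<^sub>1, \<sigma>\<^sub>2)\<in>?bad. ze e \<sigma>\<^sub>1 \<sigma>\<^sub>2)"
    and nn: "\<And>e \<sigma>\<^sub>1 \<sigma>\<^sub>2. e \<in> arcs G \<Longrightarrow> \<sigma>\<^sub>1 \<in> ?L \<Longrightarrow> \<sigma>\<^sub>2 \<in> ?L \<Longrightarrow> 0 \<le> ze e \<sigma>\<^sub>1 \<sigma>\<^sub>2"
    using assms by simp_all
  have x_nonneg: "0 \<le> x e" if "e \<in> arcs G" for e
    using that nn by (auto simp: xe intro!: sum_nonneg)
  define f where "f i v = (\<Sum>\<sigma>\<in>{\<sigma>\<in>?L. \<sigma> i = 1}. zv v \<sigma>)" for i v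
  \<comment> \<open>Mass of \<open>ze\<close> leaving labels with bit \<open>i\<close> set either
    arrives at such labels, where it is part of \<open>f i (head G e)\<close>, or at labels with bit
    \<open>i\<close> clear. Every pair of the second kind violates the order, so its mass is counted
    in \<open>x e\<close>.\<close>
  have drop: "f i (tail G e) - f i (head G e) \<le> x e" if e: "e \<in> arcs G" and i: "i \<in> {1..k}" for e i
  proof -
    let ?A = "{\<sigma>\<in>?L. \<sigma> i = 1}"
    have "f i (tail G e) = (\<Sum>(\<sigma>\<^sub>1, \<sigma>\<^sub>2)\<in>?A \<times> ?L. ze e \<sigma>\<^sub>1 \<sigma>\<^sub>2)"
      unfolding f_def using e by (simp add: tl sum.cartesian_product)
    also have "\<dots> = (\<Sum>(\<sigma>\<^sub>1, \<sigma>\<^sub>2)\<in>?A \<times> ?A. ze e \<sigma>\<^sub>1 \<sigma>\<^sub>2) + (\<Sum>(\<sigma>\<^sub>1, \<sigma>\<^sub>2)\<in>?A \<times> (?L - ?A). ze e \<sigma>\<^sub>1 \<sigma>\<^sub>2)"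
      using fin by (subst sum.union_disjoint[symmetric]) (auto intro!: sum.cong)
    also have "(\<Sum>(\<sigma>\<^sub>1, \<sigma>\<^sub>2)\<in>?A \<times> ?A. ze e \<sigma>\<^sub>1 \<sigma>\<^sub>2) \<le> (\<Sum>(\<sigma>\<^sub>1, \<sigma>\<^sub>2)\<in>?L \<times> ?A. ze e \<sigma>\<^sub>1 \<sigma>\<^sub>2)"
      using fin e nn by (intro sum_mono2) auto
    also have "\<dots> = f i (head G e)"
      unfolding f_def using e by (simp add: hd sum.cartesian_product[symmetric]) (rule sum.swap)
    also have "(\<Sum>(\<sigma>\<^sub>1, \<sigma>\<^sub>2)\<in>?A \<times> (?L - ?A). ze e \<sigma>\<^sub>1 \<sigma>\<^sub>2) \<le> (\<Sum>(\<sigma>\<^sub>1, \<sigma>\<^sub>2)\<in>?bad. ze e \<sigma>\<^sub>1 \<sigma>\<^sub>2)"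
    proof (rule sum_mono2)
      show "finite ?bad" by (rule finite_subset[of _ "?L \<times> ?L"]) (use fin in auto)
      show "?A \<times> (?L - ?A) \<subseteq> ?bad"
      proof (rule subrelI)
        fix \<sigma>\<^sub>1 \<sigma>\<^sub>2 assume h: "(\<sigma>\<^sub>1, \<sigma>\<^sub>2) \<in> ?A \<times> (?L - ?A)"
        then have "\<sigma>\<^sub>2 i = 0" using i labels_cases[of \<sigma>\<^sub>2 k i] by auto
        then show "(\<sigma>\<^sub>1, \<sigma>\<^sub>2) \<in> ?bad"
          using h i by (auto simp: label_le_def intro!: bexI[of _ i])
      qed
    qed (use e nn in auto)
    finally show ?thesis using e by (simp add: xe)
  qed
  have "1 \<le> sum x (set p)" if uv: "(u, v) \<in> arcs_ends H" and p: "G.apath u p v" for u v p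
  proof -
    have "u \<in> verts H" "v \<in> verts H" using uv by (auto dest: H.adj_in_verts)
    then obtain i j where ij: "i \<in> {1..k}" "j \<in> {1..k}" "u = s i" "v = s j"
      using terminals by auto
    have si: "s i \<in> verts G" using ij \<open>u \<in> verts H\<close> terminals_in_supply by auto
    have "f i (s i) = (\<Sum>\<sigma>\<in>?L. zv (s i) \<sigma>)"
      unfolding f_def
    proof (rule sum.mono_neutral_left)
      show "\<forall>\<sigma>\<in>?L - {\<sigma> \<in> ?L. \<sigma> i = 1}. zv (s i) \<sigma> = 0"
        using ij(1) src[OF ij(1)] labels_cases[OF _ ij(1)] by blast
    qed (use fin in auto)
    then have one: "f i (s i) = 1" using tot si by simp
    have zero: "f i (s j) = 0"
      unfolding f_def using ij uv snk by (intro sum.neutral) auto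
    have "f i (s i) - f i (s j) \<le> sum_list (map x p)"
      using p ij drop
      by (intro sum_tail_minus_head_le) (auto simp: G.apath_def G.awalk_def)
    \<comment> \<open>Telescoping counts arcs with multiplicity, the distance LP sums over a set;
      the two agree because a path repeats no arc.\<close>
    moreover have "distinct p"
      using p by (auto simp: G.apath_def intro: G.distinct_verts_imp_distinct)
    ultimately show ?thesis using one zero by (simp add: sum_list_distinct_conv_sum_set)
  qed
  then show ?thesis unfolding distance_lp_def using x_nonneg by blast
qed

section \<open>From distances to labellings\<close>

text \<open>
  The length of a walk counts repeated arcs once. This makes the set of lengths finite without
  changing distances, as a walk contains a path between its ends.
\<close>

definition reached :: "('b \<Rightarrow> real) \<Rightarrow> real \<Rightarrow> 'a \<Rightarrow> label" where
  "reached x \<theta> v =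
     (\<lambda>i\<in>{1..k}. if \<exists>p. G.awalk (s i) p v \<and> sum x (set p) \<le> \<theta> then 1 else 0)"

lemma reached_in_labels: "reached x \<theta> v \<in> labels k"
  by (auto simp: reached_def labels_def)

text \<open>The arcs of a walk form a subset of the finite set \<open>arcs G\<close>, so only
  finitely many lengths occur. Each bit is therefore set on a finite union of half-lines
  \<open>[c, \<infinity>)\<close>.\<close>

lemma borel_reached: "{\<theta>. reached x \<theta> v = \<sigma>} \<in> sets borel"
proof (cases "\<sigma> \<in> labels k")
  case False
  then have "{\<theta>. reached x \<theta> v = \<sigma>} = {}" using reached_in_labels by auto
  then show ?thesis by simp
next
  case True
  define C where "C i = (\<lambda>p. sum x (set p)) ` {p. G.awalk (s i) p v}" for i
  have finC: "finite (C i)" for i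
  proof (rule finite_subset)
    show "C i \<subseteq> sum x ` Pow (arcs G)" by (auto simp: C_def)
  qed auto
  have up: "{\<theta>. \<exists>p. G.awalk (s i) p v \<and> sum x (set p) \<le> \<theta>} \<in> sets borel" for i
  proof -
    have "{\<theta>. \<exists>p. G.awalk (s i) p v \<and> sum x (set p) \<le> \<theta>} = (\<Union>c\<in>C i. {c..})"
      by (auto simp: C_def)
    then show ?thesis using finC by auto
  qed
  have eq: "{\<theta>. reached x \<theta> v = \<sigma>} =
      {\<theta>. \<forall>i\<in>{1..k}. (\<exists>p. G.awalk (s i) p v \<and> sum x (set p) \<le> \<theta>) \<longleftrightarrow> \<sigma> i = 1}"
  proof (intro Collect_cong iffI)
    fix \<theta> assume h: "reached x \<theta> v = \<sigma>"
    show "\<forall>i\<in>{1..k}. (\<exists>p. G.awalk (s i) p v \<and> sum x (set p) \<le> \<theta>) \<longleftrightarrow> \<sigma> i = 1"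
      unfolding h[symmetric] reached_def by simp
  next
    fix \<theta>
    assume h: "\<forall>i\<in>{1..k}. (\<exists>p. G.awalk (s i) p v \<and> sum x (set p) \<le> \<theta>) \<longleftrightarrow> \<sigma> i = 1"
    show "reached x \<theta> v = \<sigma>"
    proof (rule PiE_ext)
      show "reached x \<theta> v \<in> {1..k} \<rightarrow>\<^sub>E {0, 1}" "\<sigma> \<in> {1..k} \<rightarrow>\<^sub>E {0, 1}"
        using True reached_in_labels by (auto simp: labels_def)
    next
      fix i assume i: "i \<in> {1..k}"
      then show "reached x \<theta> v i = \<sigma> i"
        using h labels_cases[OF True i] by (auto simp: reached_def)
    qed
  qed
  have [measurable]: "Measurable.pred borel (\<lambda>\<theta>. \<exists>p. G.awalk (s i) p v \<and> sum x (set p) \<le> \<theta>)" for i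
    using up[of i] by (simp add: pred_def)
  show ?thesis unfolding eq by measurable
qed

text \<open>The Label-LP determines \<open>x'\<close> from \<open>ze\<close>, and a wrap-around need
  not violate the order, so \<open>x'\<close> is in general only bounded by \<open>x\<close>. The
  integral claim is included because it concerns the same witnesses.\<close>

lemma distance_lp_imp_label_lp:
  assumes "distance_lp G H x"
  obtains zv ze x' where "label_lp G H k s (zv, ze, x')" "\<forall>e\<in>arcs G. x' e \<le> x e"
    "distance_ip G H x \<longrightarrow> label_ip G H k s (zv, ze, x')"
proof -
  let ?L = "labels k"
  have x0: "\<And>e. e \<in> arcs G \<Longrightarrow> 0 \<le> x e"
    and path: "\<And>u v p. (u, v) \<in> arcs_ends H \<Longrightarrow> G.apath u p v \<Longrightarrow> 1 \<le> sum x (set p)"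
    using assms by (auto simp: distance_lp_def)
  note fin = finite_labels[of k]
  \<comment> \<open>\<open>unit_shift\<close> maps \<open>[0, 1)\<close> to itself only for shifts
    between 0 and 1, hence the cap. For longer arcs the bound on \<open>x' e\<close> is trivial, as
    a probability is at most 1.\<close>
  define a where "a e = min 1 (x e)" for e
  have a: "0 \<le> a e" "a e \<le> 1" "a e \<le> x e" if "e \<in> arcs G" for e
    using x0[OF that] by (auto simp: a_def)
  define pair where "pair e \<theta> =
      (reached x \<theta> (tail G e), reached x (unit_shift (a e) \<theta>) (head G e))" for e \<theta>
  define bad where "bad = {(\<sigma>\<^sub>1, \<sigma>\<^sub>2) \<in> ?L \<times> ?L. \<not> label_le k \<sigma>\<^sub>1 \<sigma>\<^sub>2}"
  have finbad: "finite bad"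
    unfolding bad_def by (rule finite_subset[of _ "?L \<times> ?L"]) (use fin in auto)
  define zv where "zv v \<sigma> = unif (\<lambda>\<theta>. reached x \<theta> v = \<sigma>)" for v \<sigma>
  define ze where "ze e \<sigma>\<^sub>1 \<sigma>\<^sub>2 = unif (\<lambda>\<theta>. pair e \<theta> = (\<sigma>\<^sub>1, \<sigma>\<^sub>2))" for e \<sigma>\<^sub>1 \<sigma>\<^sub>2
  define x' where "x' e = unif (\<lambda>\<theta>. pair e \<theta> \<in> bad)" for e
  have bpair: "{\<theta>. pair e \<theta> = c} \<in> sets borel" for e c
  proof -
    have "{\<theta>. pair e \<theta> = c} = {\<theta>. reached x \<theta> (tail G e) = fst c} \<inter>
        {\<theta>. reached x (unit_shift (a e) \<theta>) (head G e) = snd c}"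
      by (auto simp: pair_def)
    then show ?thesis
      using borel_reached borel_unit_shift_vimage[OF borel_reached] by auto
  qed
  have bbad: "{\<theta>. pair e \<theta> \<in> bad} \<in> sets borel" for e
  proof -
    have "{\<theta>. pair e \<theta> \<in> bad} = (\<Union>c\<in>bad. {\<theta>. pair e \<theta> = c})" by auto
    then show ?thesis using finbad bpair by auto
  qed
  have ze_sum: "(\<Sum>(\<sigma>\<^sub>1, \<sigma>\<^sub>2)\<in>S. ze e \<sigma>\<^sub>1 \<sigma>\<^sub>2) = unif (\<lambda>\<theta>. pair e \<theta> \<in> S)" if "finite S" for e S
    using sum_unif_fibres[OF that bpair] by (simp add: ze_def case_prod_unfold)
  have mono: "label_le k (reached x \<theta> (tail G e)) (reached x (\<theta> + a e) (head G e))"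
    if e: "e \<in> arcs G" and th: "0 \<le> \<theta>" "\<theta> + a e < 1" for e \<theta>
  proof -
    \<comment> \<open>Not wrapping forces \<open>a e < 1\<close>, so the cap is inactive and the
      shift is the full length of the arc.\<close>
    have ae: "a e = x e" using th by (auto simp: a_def)
    have "\<exists>q. G.awalk (s i) q (head G e) \<and> sum x (set q) \<le> \<theta> + x e"
      if p: "G.awalk (s i) p (tail G e)" "sum x (set p) \<le> \<theta>" for i p
    proof (intro exI conjI)
      show "G.awalk (s i) (p @ [e]) (head G e)"
        using p e by (intro G.awalk_appendI[OF p(1)] G.arc_implies_awalk) auto
      \<comment> \<open>If \<open>e\<close> already lies on \<open>p\<close>, its length is not
        counted again, and \<open>0 \<le> x e\<close> gives the bound.\<close>
      have "sum x (set (p @ [e])) \<le> sum x (set p) + x e"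
        using x0[OF e] by (cases "e \<in> set p") (auto simp: insert_absorb)
      then show "sum x (set (p @ [e])) \<le> \<theta> + x e" using p by simp
    qed
    then show ?thesis unfolding label_le_def ae by (auto simp: reached_def)
  qed
  have x'_le: "x' e \<le> x e" if e: "e \<in> arcs G" for e
  proof -
    \<comment> \<open>Labels can be out of order only where the rotation wraps around, on
      \<open>[1 - a e, 1)\<close>, an interval of length \<open>a e\<close>.\<close>
    have "x' e \<le> unif (\<lambda>\<theta>. 1 - a e \<le> \<theta>)"
      unfolding x'_def
    proof (rule unif_mono[OF bbad])
      show "{\<theta>. 1 - a e \<le> \<theta>} \<in> sets borel" by measurable
      fix \<theta> assume th: "0 \<le> \<theta>" "pair e \<theta> \<in> bad"
      show "1 - a e \<le> \<theta>"
      proof (rule ccontr)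
        assume "\<not> ?thesis"
        then have "\<theta> + a e < 1" by simp
        with mono[OF e th(1)] th(2) show False by (auto simp: pair_def bad_def unit_shift_def)
      qed
    qed
    also have "{\<theta> \<in> {0..<1}. 1 - a e \<le> \<theta>} = {1 - a e..<1}" using a[OF e] by auto
    then have "unif (\<lambda>\<theta>. 1 - a e \<le> \<theta>) = a e" using a[OF e] by (simp add: unif_def)
    also have "a e \<le> x e" using a[OF e] by simp
    finally show ?thesis .
  qed
  have label: "label_lp G H k s (zv, ze, x')"
    unfolding label_lp.simps
  proof (intro conjI ballI impI)
    fix v show "(\<Sum>\<sigma>\<in>?L. zv v \<sigma>) = 1"
      using sum_unif_fibres[OF fin borel_reached, of x v] reached_in_labels unif_True
      by (simp add: zv_def)
  next
    fix i and \<sigma> :: label assume i: "i \<in> {1..k}" and "\<sigma> i = 0"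
    have "s i \<in> verts G" using i terminals terminals_in_supply by auto
    then have "G.awalk (s i) [] (s i)" by (simp add: G.awalk_Nil_iff)
    then have "reached x \<theta> (s i) i = 1" if "0 \<le> \<theta>" for \<theta>
      using that i by (auto simp: reached_def intro!: exI[of _ "[]"])
    then show "zv (s i) \<sigma> = 0"
      unfolding zv_def using \<open>\<sigma> i = 0\<close> by (intro unif_eq_0) force
  next
    fix i j and \<sigma> :: label assume i: "i \<in> {1..k}" and ij: "(s i, s j) \<in> arcs_ends H" and "\<sigma> i = 1"
    \<comment> \<open>Shortcutting a walk to a path shows that every walk from \<open>s i\<close> to
      \<open>s j\<close> has length at least 1. The threshold range must exclude 1, where
      \<open>s j\<close> could be reached.\<close>
    have "reached x \<theta> (s j) i = 0" if "\<theta> < 1" for \<theta>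
    proof -
      have "1 \<le> sum x (set p)" if p: "G.awalk (s i) p (s j)" for p
      proof -
        have "1 \<le> sum x (set (G.awalk_to_apath p))"
          using path[OF ij] G.apath_awalk_to_apath[OF p] by blast
        also have "\<dots> \<le> sum x (set p)"
          using G.awalk_to_apath_subset[OF p] p x0 by (intro sum_mono2) (auto simp: G.awalk_def)
        finally show ?thesis .
      qed
      then show ?thesis using that i by (force simp: reached_def)
    qed
    then show "zv (s j) \<sigma> = 0"
      unfolding zv_def using \<open>\<sigma> i = 1\<close> by (intro unif_eq_0) force
  next
    fix e \<sigma> assume "e \<in> arcs G" and \<sigma>: "\<sigma> \<in> ?L"
    have "(\<Sum>\<sigma>\<^sub>2\<in>?L. ze e \<sigma> \<sigma>\<^sub>2) = (\<Sum>(\<sigma>\<^sub>1, \<sigma>\<^sub>2)\<in>{\<sigma>} \<times> ?L. ze e \<sigma>\<^sub>1 \<sigma>\<^sub>2)"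
      by (simp add: sum.cartesian_product[symmetric])
    also have "\<dots> = unif (\<lambda>\<theta>. pair e \<theta> \<in> {\<sigma>} \<times> ?L)" using fin by (intro ze_sum) auto
    also have "\<dots> = zv (tail G e) \<sigma>"
      unfolding zv_def by (rule unif_cong) (auto simp: pair_def reached_in_labels)
    finally show "(\<Sum>\<sigma>\<^sub>2\<in>?L. ze e \<sigma> \<sigma>\<^sub>2) = zv (tail G e) \<sigma>" .
  next
    fix e \<sigma> assume e: "e \<in> arcs G" and \<sigma>: "\<sigma> \<in> ?L"
    have "(\<Sum>\<sigma>\<^sub>1\<in>?L. ze e \<sigma>\<^sub>1 \<sigma>) = (\<Sum>(\<sigma>\<^sub>1, \<sigma>\<^sub>2)\<in>?L \<times> {\<sigma>}. ze e \<sigma>\<^sub>1 \<sigma>\<^sub>2)"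
      by (simp add: sum.cartesian_product[symmetric])
    also have "\<dots> = unif (\<lambda>\<theta>. pair e \<theta> \<in> ?L \<times> {\<sigma>})" using fin by (intro ze_sum) auto
    also have "\<dots> = unif (\<lambda>\<theta>. reached x (unit_shift (a e) \<theta>) (head G e) = \<sigma>)"
      by (rule unif_cong) (auto simp: pair_def reached_in_labels)
    also have "\<dots> = zv (head G e) \<sigma>"
      unfolding zv_def using a[OF e] by (intro unif_unit_shift borel_reached) auto
    finally show "(\<Sum>\<sigma>\<^sub>1\<in>?L. ze e \<sigma>\<^sub>1 \<sigma>) = zv (head G e) \<sigma>" .
  next
    fix e
    show "x' e = (\<Sum>(\<sigma>\<^sub>1, \<sigma>\<^sub>2)\<in>{(\<sigma>\<^sub>1, \<sigma>\<^sub>2) \<in> ?L \<times> ?L. \<not> label_le k \<sigma>\<^sub>1 \<sigma>\<^sub>2}. ze e \<sigma>\<^sub>1 \<sigma>\<^sub>2)"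
      using ze_sum[OF finbad] by (simp add: x'_def bad_def)
  qed (auto simp: zv_def ze_def intro!: unif_nonneg unif_le_1 borel_reached bpair)
  have "label_ip G H k s (zv, ze, x')" if "distance_ip G H x"
  proof -
    have x01: "\<And>e. e \<in> arcs G \<Longrightarrow> x e \<in> {0, 1}" using that by (auto simp: distance_ip_def)
    have const: "reached x \<theta> v = reached x 0 v" if "0 \<le> \<theta>" "\<theta> < 1" for \<theta> v
    proof -
      \<comment> \<open>Lengths are integers, and no integer lies strictly between 0 and 1.\<close>
      have "sum x (set p) \<le> \<theta> \<longleftrightarrow> sum x (set p) \<le> 0" if "G.awalk u p v" for u p
      proof -
        have "sum x (set p) \<in> \<int>"
          using that x01 by (intro Ints_sum) fastforce
        then show ?thesis using \<open>0 \<le> \<theta>\<close> \<open>\<theta> < 1\<close> by (auto elim!: Ints_cases)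
      qed
      then show ?thesis unfolding reached_def by (intro restrict_ext) metis
    qed
    \<comment> \<open>The rotated threshold stays in \<open>[0, 1)\<close>, so \<open>const\<close>
      also applies at the head.\<close>
    have const_pair: "pair e \<theta> = pair e 0" if "e \<in> arcs G" "0 \<le> \<theta>" "\<theta> < 1" for e \<theta>
      using that const unit_shift_range[OF a(1,2)] unfolding pair_def
      by (metis order_refl zero_less_one)
    show ?thesis unfolding label_ip.simps
    proof (intro conjI ballI label)
      show "zv v \<sigma> \<in> {0, 1}" for v \<sigma>
        unfolding zv_def by (rule unif_constant) (metis const)
      show "ze e \<sigma>\<^sub>1 \<sigma>\<^sub>2 \<in> {0, 1}" if "e \<in> arcs G" for e \<sigma>\<^sub>1 \<sigma>\<^sub>2
        unfolding ze_def using const_pair[OF that] by (intro unif_constant) metis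
      show "x' e \<in> {0, 1}" if "e \<in> arcs G" for e
        unfolding x'_def using const_pair[OF that] by (intro unif_constant) metis
    qed
  qed
  then show thesis using that label x'_le by blast
qed

section \<open>Existence and comparison of optima\<close>

lemma cost_mono: "(\<And>e. e \<in> arcs G \<Longrightarrow> x e \<le> y e) \<Longrightarrow> cost G w x \<le> cost G w y"
  unfolding cost_def by (intro sum_mono mult_left_mono weight_nonneg)

text \<open>Provides a feasible point. The demand graph has no loops, so every path to be cut has at
  least one arc.\<close>

lemma distance_lp_all_ones: "distance_lp G H (\<lambda>_. 1)"
  unfolding distance_lp_def
proof (intro conjI allI impI ballI)
  fix u v p assume "(u, v) \<in> arcs_ends H \<and> G.apath u p v"
  then have "u \<noteq> v" "G.awalk u p v"
    using H.adj_not_same by (auto simp: G.apath_def)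
  then have "p \<noteq> []" by (auto simp: G.awalk_Nil_iff)
  then have "card (set p) \<ge> 1" by (simp add: Suc_le_eq card_gt_0_iff)
  then show "1 \<le> (\<Sum>e\<in>set p. 1 :: real)" by simp
qed auto

text \<open>\<open>D\<close> is \<open>[0, 1]\<close> in the fractional and \<open>{0, 1}\<close> in
  the integral case. The constraints are closed conditions and the cost is continuous, so
  compactness gives a minimum; \<open>1 \<in> D\<close> makes the constant 1 an admissible
  point.\<close>

lemma distance_lp_attains_min_on:
  assumes "compact D" "1 \<in> D"
  obtains x where "distance_lp G H x" "\<forall>e\<in>arcs G. x e \<in> D"
    "\<And>y. distance_lp G H y \<Longrightarrow> \<forall>e\<in>arcs G. y e \<in> D \<Longrightarrow> cost G w x \<le> cost G w y"
proof -
  \<comment> \<open>Elements of \<open>'b\<close> outside \<open>arcs G\<close> are unconstrained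
    coordinates, possibly infinitely many. Fixing them at 0 makes \<open>K\<close> a product of
    compact sets, compact by Tychonoff's theorem.\<close>
  define K where "K = PiE UNIV (\<lambda>e. if e \<in> arcs G then D else {0})"
  have "compactin (product_topology (\<lambda>_. euclidean) UNIV) K"
    unfolding K_def compactin_PiE using assms by (simp add: compactin_euclidean_iff)
  then have "compact K" by (simp add: euclidean_product_topology compactin_euclidean_iff)
  have coord: "continuous_on UNIV (\<lambda>x::'b \<Rightarrow> real. x e)" for e by simp
  have "closed {x. distance_lp G H x}"
    unfolding distance_lp_def Ball_def
    by (intro closed_Collect_conj closed_Collect_all closed_Collect_imp closed_Collect_le
        open_Collect_const continuous_on_sum continuous_on_const coord)
  then have comp: "compact (K \<inter> {x. distance_lp G H x})"
    by (rule compact_Int_closed[OF \<open>compact K\<close>])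
  have cont: "continuous_on (K \<inter> {x. distance_lp G H x}) (cost G w)"
    unfolding cost_def by (intro continuous_intros continuous_on_subset[OF coord]) auto
  \<comment> \<open>Zeroing the coordinates outside \<open>arcs G\<close> leaves path sums and cost
    unchanged, so minimality over \<open>K\<close> carries over to all feasible \<open>y\<close>
    with values in \<open>D\<close> on the arcs.\<close>
  have trunc: "distance_lp G H (\<lambda>e. if e \<in> arcs G then y e else 0)"
    if "distance_lp G H y" for y
  proof -
    have "sum (\<lambda>e. if e \<in> arcs G then y e else 0) (set p) = sum y (set p)"
      if "G.apath u p v" for u p v
      using that by (intro sum.cong) (auto simp: G.apath_def)
    then show ?thesis using that unfolding distance_lp_def by auto
  qed
  have truncK: "(\<lambda>e. if e \<in> arcs G then y e else 0) \<in> K" if "\<forall>e\<in>arcs G. y e \<in> D" for y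
    using that by (auto simp: K_def)
  have "K \<inter> {x. distance_lp G H x} \<noteq> {}"
    using trunc[OF distance_lp_all_ones] truncK[of "\<lambda>_. 1"] assms by auto
  with comp cont obtain x where x: "x \<in> K \<inter> {x. distance_lp G H x}"
    and min: "\<And>y. y \<in> K \<inter> {x. distance_lp G H x} \<Longrightarrow> cost G w x \<le> cost G w y"
    using continuous_attains_inf[of "K \<inter> {x. distance_lp G H x}" "cost G w"] by blast
  show thesis
  proof (rule that)
    show "distance_lp G H x" using x by simp
    have "x e \<in> (if e \<in> arcs G then D else {0})" for e using x by (auto simp: K_def PiE_iff)
    then show "\<forall>e\<in>arcs G. x e \<in> D" by metis
    fix y assume y: "distance_lp G H y" "\<forall>e\<in>arcs G. y e \<in> D"
    have "cost G w x \<le> cost G w (\<lambda>e. if e \<in> arcs G then y e else 0)"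
      using min trunc truncK y by blast
    also have "\<dots> = cost G w y" unfolding cost_def by (intro sum.cong) auto
    finally show "cost G w x \<le> cost G w y" .
  qed
qed

lemma distance_ip_attains_min: "\<exists>x. is_arg_min (cost G w) (distance_ip G H) x"
proof -
  obtain x where "distance_lp G H x" "\<forall>e\<in>arcs G. x e \<in> {0, 1}"
    "\<And>y. distance_lp G H y \<Longrightarrow> \<forall>e\<in>arcs G. y e \<in> {0, 1} \<Longrightarrow> cost G w x \<le> cost G w y"
    by (rule distance_lp_attains_min_on[of "{0, 1}"]) (auto intro: finite_imp_compact)
  then show ?thesis unfolding is_arg_min_def distance_ip_def by (meson not_le)
qed

lemma distance_lp_attains_min: "\<exists>x. is_arg_min (cost G w) (distance_lp G H) x"
proof -
  obtain x where x: "distance_lp G H x"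
    and min: "\<And>y. distance_lp G H y \<Longrightarrow> \<forall>e\<in>arcs G. y e \<in> {0..1} \<Longrightarrow> cost G w x \<le> cost G w y"
    by (rule distance_lp_attains_min_on[of "{0..1}"]) auto
  have "cost G w x \<le> cost G w y" if y: "distance_lp G H y" for y
  proof -
    have y0: "\<forall>e\<in>arcs G. 0 \<le> y e" using y by (auto simp: distance_lp_def)
    \<comment> \<open>A path either has an arc with \<open>y e\<close> at least 1, whose capped
      value alone suffices, or its sum is unaffected by the cap.\<close>
    have "distance_lp G H (\<lambda>e. min 1 (y e))"
      unfolding distance_lp_def
    proof (intro conjI allI impI ballI)
      fix u v p assume p: "(u, v) \<in> arcs_ends H \<and> G.apath u p v"
      then have sub: "set p \<subseteq> arcs G" by (auto simp: G.apath_def)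
      show "1 \<le> (\<Sum>e\<in>set p. min 1 (y e))"
      proof (cases "\<exists>e\<in>set p. 1 \<le> y e")
        case True
        then obtain e where e: "e \<in> set p" "1 \<le> y e" by auto
        then have "min 1 (y e) \<le> (\<Sum>e\<in>set p. min 1 (y e))"
          using sub y0 by (intro member_le_sum) auto
        with e show ?thesis by simp
      next
        case False
        then have "(\<Sum>e\<in>set p. min 1 (y e)) = sum y (set p)" by (intro sum.cong) auto
        then show ?thesis using y p by (auto simp: distance_lp_def)
      qed
    qed (use y0 in auto)
    then have "cost G w x \<le> cost G w (\<lambda>e. min 1 (y e))" using y0 by (intro min) auto
    also have "\<dots> \<le> cost G w y" by (intro cost_mono) auto
    finally show ?thesis .
  qed
  then show ?thesis using x unfolding is_arg_min_def by (meson not_le)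
qed

text \<open>\<open>D\<close> and \<open>L\<close> stand for the fractional or the integral problems.
  Translating an optimal \<open>x\<close> gives a label solution of no larger cost; its arc values
  are again feasible for \<open>D\<close>, so the costs agree. Since every label solution yields a
  point of \<open>D\<close> of equal cost, this one is optimal.\<close>

lemma common_opt_value:
  assumes attained: "\<exists>x. is_arg_min (cost G w) D x"
    and sound: "\<And>zv ze x. L (zv, ze, x) \<Longrightarrow> D x"
    and complete: "\<And>x. D x \<Longrightarrow> \<exists>zv ze x'. L (zv, ze, x') \<and> (\<forall>e\<in>arcs G. x' e \<le> x e)"
  shows "\<exists>m. is_opt_value L (label_cost G w) m \<and> is_opt_value D (cost G w) m"
proof -
  obtain x where x: "D x" and min: "\<And>y. D y \<Longrightarrow> cost G w x \<le> cost G w y"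
    using attained unfolding is_arg_min_def by (meson not_le)
  obtain zv ze x' where z: "L (zv, ze, x')" and le: "\<forall>e\<in>arcs G. x' e \<le> x e"
    using complete[OF x] by blast
  have eq: "cost G w x' = cost G w x"
    using min[OF sound[OF z]] cost_mono[of x' x] le by auto
  have "is_arg_min (label_cost G w) L (zv, ze, x')"
    unfolding is_arg_min_def using z min sound by (auto simp: eq not_less)
  moreover have "is_arg_min (cost G w) D x"
    unfolding is_arg_min_def using x min by (auto simp: not_less)
  ultimately show ?thesis
    unfolding is_opt_value_def using eq by (intro exI[of _ "cost G w x"]) force
qed

end

theorem theorem7:
  fixes G :: "('a, 'b) pre_digraph" and H :: "('a, 'c) pre_digraph"
    and w :: "'b \<Rightarrow> real" and k :: nat and s :: "nat \<Rightarrow> 'a"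
  assumes "directed_multicut G H w k s"
  shows "(\<exists>m. is_opt_value (label_lp G H k s) (label_cost G w) m \<and>
              is_opt_value (distance_lp G H) (cost G w) m) \<and>
         (\<exists>m. is_opt_value (label_ip G H k s) (label_cost G w) m \<and>
              is_opt_value (distance_ip G H) (cost G w) m)"
proof -
  interpret directed_multicut G H w k s by (rule assms)
  show ?thesis
  proof (intro conjI common_opt_value distance_lp_attains_min distance_ip_attains_min)
    show "distance_lp G H x" if "label_lp G H k s (zv, ze, x)" for zv ze x
      using that by (rule label_lp_imp_distance_lp)
    show "\<exists>zv ze x'. label_lp G H k s (zv, ze, x') \<and> (\<forall>e\<in>arcs G. x' e \<le> x e)"
      if "distance_lp G H x" for x
      using distance_lp_imp_label_lp[OF that] by metis
    show "distance_ip G H x" if "label_ip G H k s (zv, ze, x)" for zv ze x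
      using that label_lp_imp_distance_lp by (auto simp: distance_ip_def simp del: label_lp.simps)
    show "\<exists>zv ze x'. label_ip G H k s (zv, ze, x') \<and> (\<forall>e\<in>arcs G. x' e \<le> x e)"
      if "distance_ip G H x" for x
      using distance_lp_imp_label_lp[of x] that unfolding distance_ip_def by metis
  qed
qed

end
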